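(* Every infinite-dimensional Young diagram $Y$, equipped with the restriction of the operation $x\cdot y=(x\wedge y)-x$ of $(\mathbb{Z}^{\omega})^-$, is a finite regular $L$-algebra, and the assignment $Y\mapsto (Y,\cdot)$ induces a bijective correspondence between conjugacy classes of infinite-dimensional Young diagrams and isomorphism classes of finite regular $L$-algebras.
   Context: An $L$-algebra is a set $X$ together with a binary operation $(x,y)\mapsto x\cdot y$ such that: (i) there exists $e\in X$ with $e\cdot x=x$ and $x\cdot e=x\cdot x=e$ for all $x\in X$; (ii) $(x\cdot y)\cdot(x\cdot z)=(y\cdot x)\cdot(y\cdot z)$ for all $x,y,z\in X$; (iii) if $x\cdot y=y\cdot x=e$, then $x=y$. The natural order is $x\le y\iff x\cdot y=e$. $X$ is semiregular if $((x\cdot y)\cdot z)\cdot((y\cdot x)\cdot z)=((x\cdot y)\cdot z)\cdot z$ for all $x,y,z\in X$; $X$ is regular if it is semiregular and for all $x\le y$ in $X$ there is $z\ge x$ with $z\cdot x=y$. An isomorphism of $L$-algebras is a bijection $f$ with $f(x\cdot y)=f(x)\cdot f(y)$. Let $\mathbb{Z}^{\omega}=\bigoplus_{i\ge1}\mathbb{Z}$ be the group of integer sequences with finitely many nonzero entries, ordered coordinatewise, with coordinatewise meet $\wedge$ (minimum); its negative cone is $(\mathbb{Z}^{\omega})^-=\{g: g_i\le 0\text{ for all }i\}$, which is an $L$-algebra with logical unit $0$ under $x\cdot y=(x\wedge y)-x$ (coordinatewise $\min(0,y_i-x_i)$). An infinite-dimensional Young diagram is a finite, non-empty subset $Y\subseteq(\mathbb{Z}^{\omega})^-$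 that is upwards-closed, i.e. if $x\in Y$, $y\in(\mathbb{Z}^{\omega})^-$ and $y\ge x$, then $y\in Y$. Two such diagrams are conjugate if one is carried to the other by a permutation of the coordinates of $\mathbb{Z}^{\omega}$. *)

theory Defs
  imports Main "HOL-Library.Infinite_Typeclass"
begin

definition logical_unit :: "'a set \<Rightarrow> ('a \<Rightarrow> 'a \<Rightarrow> 'a) \<Rightarrow> 'a \<Rightarrow> bool" where
  "logical_unit X m e \<longleftrightarrow> e \<in> X \<and> (\<forall>x\<in>X. m e x = x \<and> m x e = e \<and> m x x = e)"

definition L_algebra :: "'a set \<Rightarrow> ('a \<Rightarrow> 'a \<Rightarrow> 'a) \<Rightarrow> bool" where
  "L_algebra X m \<longleftrightarrow>
     (\<forall>x\<in>X. \<forall>y\<in>X. m x y \<in> X) \<and>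
     (\<exists>e. logical_unit X m e \<and>
       (\<forall>x\<in>X. \<forall>y\<in>X. \<forall>z\<in>X. m (m x y) (m x z) = m (m y x) (m y z)) \<and>
       (\<forall>x\<in>X. \<forall>y\<in>X. m x y = e \<and> m y x = e \<longrightarrow> x = y))"

text \<open>The logical unit of an L-algebra is unique, so the following says that
  \<open>m x y\<close> is equal to it.\<close>

definition natural_le :: "'a set \<Rightarrow> ('a \<Rightarrow> 'a \<Rightarrow> 'a) \<Rightarrow> 'a \<Rightarrow> 'a \<Rightarrow> bool" where
  "natural_le X m x y \<longleftrightarrow> logical_unit X m (m x y)"

definition semiregular :: "'a set \<Rightarrow> ('a \<Rightarrow> 'a \<Rightarrow> 'a) \<Rightarrow> bool" where
  "semiregular X m \<longleftrightarrow>
     (\<forall>x\<in>X. \<forall>y\<in>X. \<forall>z\<in>X.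
        m (m (m x y) z) (m (m y x) z) = m (m (m x y) z) z)"

definition regular :: "'a set \<Rightarrow> ('a \<Rightarrow> 'a \<Rightarrow> 'a) \<Rightarrow> bool" where
  "regular X m \<longleftrightarrow>
     semiregular X m \<and>
     (\<forall>x\<in>X. \<forall>y\<in>X. natural_le X m x y \<longrightarrow> (\<exists>z\<in>X. natural_le X m x z \<and> m z x = y))"

definition finite_regular_L_algebras :: "('a set \<times> ('a \<Rightarrow> 'a \<Rightarrow> 'a)) set" where
  "finite_regular_L_algebras = {(X, m). finite X \<and> L_algebra X m \<and> regular X m}"

definition L_isomorphic ::
    "'a set \<times> ('a \<Rightarrow> 'a \<Rightarrow> 'a) \<Rightarrow> 'b set \<times> ('b \<Rightarrow> 'b \<Rightarrow> 'b) \<Rightarrow> bool" where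
  "L_isomorphic A B \<longleftrightarrow>
     (\<exists>f. bij_betw f (fst A) (fst B) \<and>
          (\<forall>x\<in>fst A. \<forall>y\<in>fst A. f (snd A x y) = snd B (f x) (f y)))"

definition L_iso_rel ::
    "(('a set \<times> ('a \<Rightarrow> 'a \<Rightarrow> 'a)) \<times> ('a set \<times> ('a \<Rightarrow> 'a \<Rightarrow> 'a))) set" where
  "L_iso_rel = {(A, B). A \<in> finite_regular_L_algebras \<and> B \<in> finite_regular_L_algebras \<and>
                        L_isomorphic A B}"

text \<open>Integer sequences are functions \<open>nat \<Rightarrow> int\<close>; order, \<open>inf\<close> and subtraction
  on this function type are the pointwise ones.\<close>

definition Z_omega :: "(nat \<Rightarrow> int) set" where
  "Z_omega = {g. finite {i. g i \<noteq> 0}}"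

definition neg_cone :: "(nat \<Rightarrow> int) set" where
  "neg_cone = {g \<in> Z_omega. \<forall>i. g i \<le> 0}"

definition cone_op :: "(nat \<Rightarrow> int) \<Rightarrow> (nat \<Rightarrow> int) \<Rightarrow> (nat \<Rightarrow> int)" where
  "cone_op x y = inf x y - x"

definition young_diagrams :: "(nat \<Rightarrow> int) set set" where
  "young_diagrams =
     {Y. finite Y \<and> Y \<noteq> {} \<and> Y \<subseteq> neg_cone \<and>
         (\<forall>x\<in>Y. \<forall>y\<in>neg_cone. x \<le> y \<longrightarrow> y \<in> Y)}"

definition conj_rel :: "((nat \<Rightarrow> int) set \<times> (nat \<Rightarrow> int) set) set" where
  "conj_rel = {(Y, Y'). Y \<in> young_diagrams \<and> Y' \<in> young_diagrams \<and>
                        (\<exists>\<pi>. bij \<pi> \<and> Y' = (\<lambda>g. g \<circ> \<pi>) ` Y)}"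

text \<open>The map induced on classes: a set \<open>C\<close> of diagrams goes to all finite regular
  L-algebras over the type \<open>'a\<close> that are isomorphic to a member of \<open>C\<close>. This is a
  single isomorphism class only if the members of \<open>C\<close> are isomorphic to one another.\<close>

definition induced_class ::
    "(nat \<Rightarrow> int) set set \<Rightarrow> ('a set \<times> ('a \<Rightarrow> 'a \<Rightarrow> 'a)) set" where
  "induced_class C =
     {A \<in> finite_regular_L_algebras. \<exists>Y\<in>C. L_isomorphic (Y, cone_op) A}"

lemma L_isomorphic_refl: "L_isomorphic A A"
  unfolding L_isomorphic_def by (rule exI[of _ id]) simp

lemma L_isomorphic_sym:
  assumes "L_isomorphic A B" and "\<forall>x\<in>fst A. \<forall>y\<in>fst A. snd A x y \<in> fst A"
  shows "L_isomorphic B A"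
proof -
  obtain f where f: "bij_betw f (fst A) (fst B)"
    and h: "\<And>x y. x \<in> fst A \<Longrightarrow> y \<in> fst A \<Longrightarrow> f (snd A x y) = snd B (f x) (f y)"
    using assms(1) unfolding L_isomorphic_def by blast
  let ?g = "inv_into (fst A) f"
  have g: "bij_betw ?g (fst B) (fst A)" using f by (rule bij_betw_inv_into)
  have "?g (snd B x y) = snd A (?g x) (?g y)" if "x \<in> fst B" "y \<in> fst B" for x y
  proof -
    have gx: "?g x \<in> fst A" "?g y \<in> fst A" using g that by (auto simp: bij_betw_def)
    have "f (snd A (?g x) (?g y)) = snd B x y"
      using h[OF gx] f that by (simp add: bij_betw_inv_into_right)
    moreover have "snd A (?g x) (?g y) \<in> fst A" using assms(2) gx by blast
    ultimately show ?thesis using f by (metis bij_betw_inv_into_left)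
  qed
  then show ?thesis unfolding L_isomorphic_def using g by blast
qed

lemma L_isomorphic_trans:
  assumes "L_isomorphic A B" and "L_isomorphic B C"
  shows "L_isomorphic A C"
proof -
  obtain f g where f: "bij_betw f (fst A) (fst B)" and g: "bij_betw g (fst B) (fst C)"
    and h: "\<forall>x\<in>fst A. \<forall>y\<in>fst A. f (snd A x y) = snd B (f x) (f y)"
           "\<forall>x\<in>fst B. \<forall>y\<in>fst B. g (snd B x y) = snd C (g x) (g y)"
    using assms unfolding L_isomorphic_def by blast
  have "bij_betw (g \<circ> f) (fst A) (fst C)" using f g by (rule bij_betw_trans)
  moreover have "\<forall>x\<in>fst A. \<forall>y\<in>fst A. (g \<circ> f) (snd A x y) = snd C ((g \<circ> f) x) ((g \<circ> f) y)"
    using h bij_betwE[OF f] by simp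
  ultimately show ?thesis unfolding L_isomorphic_def by blast
qed

lemma equiv_L_iso_rel: "equiv finite_regular_L_algebras L_iso_rel"
proof (rule equivI)
  show "L_iso_rel \<subseteq> finite_regular_L_algebras \<times> finite_regular_L_algebras"
    by (auto simp: L_iso_rel_def)
  show "refl_on finite_regular_L_algebras L_iso_rel"
    by (auto simp: refl_on_def L_iso_rel_def L_isomorphic_refl)
  show "sym L_iso_rel"
    by (rule symI)
      (auto simp: L_iso_rel_def finite_regular_L_algebras_def L_algebra_def
        intro!: L_isomorphic_sym)
  show "trans L_iso_rel"
    by (rule transI) (auto simp: L_iso_rel_def intro: L_isomorphic_trans)
qed

lemma equiv_conj_rel: "equiv young_diagrams conj_rel"
proof (rule equivI)
  show "conj_rel \<subseteq> young_diagrams \<times> young_diagrams"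
    by (auto simp: conj_rel_def)
  show "refl_on young_diagrams conj_rel"
    by (auto simp: refl_on_def conj_rel_def intro!: exI[of _ id])
  show "sym conj_rel"
  proof (rule symI)
    fix Y Z assume "(Y, Z) \<in> conj_rel"
    then obtain p where p: "bij p" "Z = (\<lambda>g. g \<circ> p) ` Y"
      and YZ: "Y \<in> young_diagrams" "Z \<in> young_diagrams"
      by (auto simp: conj_rel_def)
    have "p \<circ> inv p = id" using p(1) by (simp add: bij_is_surj surj_iff[symmetric])
    then have "Y = (\<lambda>g. g \<circ> inv p) ` Z"
      unfolding p(2) by (simp add: image_image comp_assoc)
    then show "(Z, Y) \<in> conj_rel"
      using YZ bij_imp_bij_inv[OF p(1)] unfolding conj_rel_def by blast
  qed
  show "trans conj_rel"
  proof (rule transI)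
    fix X Y Z assume "(X, Y) \<in> conj_rel" "(Y, Z) \<in> conj_rel"
    then obtain p q where pq: "bij p" "bij q" "Y = (\<lambda>g. g \<circ> p) ` X" "Z = (\<lambda>g. g \<circ> q) ` Y"
      and XZ: "X \<in> young_diagrams" "Z \<in> young_diagrams"
      by (auto simp: conj_rel_def)
    have "Z = (\<lambda>g. g \<circ> (p \<circ> q)) ` X"
      unfolding pq(3,4) by (simp add: image_image comp_assoc)
    then show "(X, Z) \<in> conj_rel"
      using XZ bij_comp[OF pq(2,1)] unfolding conj_rel_def by blast
  qed
qed

end

theory Submission
  imports Defs
begin

text \<open>In a semiregular L-algebra \<open>y \<le> x \<cdot> y\<close>, so \<open>a \<cdot> b = b\<close> for distinct coatoms.
  Regularity makes \<open>z \<mapsto> z \<cdot> x\<close> map the up-set of \<open>x\<close> onto itself; by finiteness this map is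
  injective, so \<open>x < a \<cdot> x\<close> whenever \<open>a\<close> is a coatom above \<open>x\<close>. Hence applying \<open>a \<cdot> _\<close> repeatedly
  to \<open>x\<close> leaves the down-set of \<open>a\<close> after a finite number of steps, the multiplicity of \<open>a\<close> in
  \<open>x\<close>. Operators \<open>a \<cdot> _\<close> and \<open>b \<cdot> _\<close> of coatoms commute, and the negated multiplicities embed
  the algebra into the negative cone. Conversely, in a Young diagram
  \<open>x = a + a \<cdot> x\<close> for every coatom \<open>a \<ge> x\<close>, so an isomorphism of diagrams is determined by
  its action on the coatoms, that is, on the coordinates.\<close>

section \<open>Finite regular L-algebras\<close>

text \<open>The unit is a parameter, so the natural order can be written as the equation
  \<open>x \<cdot> y = e\<close>.\<close>

locale fin_reg_L_algebra =
  fixes X :: "'a set" and m :: "'a \<Rightarrow> 'a \<Rightarrow> 'a" (infixl "\<cdot>" 70) and e :: 'a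
  assumes fin: "finite X"
    and closed [simp]: "x \<in> X \<Longrightarrow> y \<in> X \<Longrightarrow> x \<cdot> y \<in> X"
    and unit_in [simp]: "e \<in> X"
    and unit_left [simp]: "x \<in> X \<Longrightarrow> e \<cdot> x = x"
    and unit_right [simp]: "x \<in> X \<Longrightarrow> x \<cdot> e = e"
    and self [simp]: "x \<in> X \<Longrightarrow> x \<cdot> x = e"
    and cycl: "x \<in> X \<Longrightarrow> y \<in> X \<Longrightarrow> z \<in> X \<Longrightarrow> (x \<cdot> y) \<cdot> (x \<cdot> z) = (y \<cdot> x) \<cdot> (y \<cdot> z)"
    and antisym: "x \<in> X \<Longrightarrow> y \<in> X \<Longrightarrow> x \<cdot> y = e \<Longrightarrow> y \<cdot> x = e \<Longrightarrow> x = y"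
    and semireg: "x \<in> X \<Longrightarrow> y \<in> X \<Longrightarrow> z \<in> X \<Longrightarrow>
      ((x \<cdot> y) \<cdot> z) \<cdot> ((y \<cdot> x) \<cdot> z) = ((x \<cdot> y) \<cdot> z) \<cdot> z"
    and reg: "x \<in> X \<Longrightarrow> y \<in> X \<Longrightarrow> x \<cdot> y = e \<Longrightarrow> \<exists>z\<in>X. x \<cdot> z = e \<and> z \<cdot> x = y"

lemma logical_unit_unique:
  assumes "logical_unit X m e" and "logical_unit X m e'"
  shows "e' = e"
  using assms unfolding logical_unit_def by metis

lemma natural_le_iff:
  assumes "logical_unit X m e"
  shows "natural_le X m x y \<longleftrightarrow> m x y = e"
  using assms logical_unit_unique[OF assms] unfolding natural_le_def by metis

lemma fin_reg_L_algebra_iff: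
  "(X, m) \<in> finite_regular_L_algebras \<longleftrightarrow> (\<exists>e. fin_reg_L_algebra X m e)"
proof
  assume "(X, m) \<in> finite_regular_L_algebras"
  then have A: "finite X" "L_algebra X m" "semiregular X m"
    and reg: "\<forall>x\<in>X. \<forall>y\<in>X. natural_le X m x y \<longrightarrow> (\<exists>z\<in>X. natural_le X m x z \<and> m z x = y)"
    unfolding finite_regular_L_algebras_def regular_def by simp_all
  then obtain e where e: "logical_unit X m e"
    "\<forall>x\<in>X. \<forall>y\<in>X. \<forall>z\<in>X. m (m x y) (m x z) = m (m y x) (m y z)"
    "\<forall>x\<in>X. \<forall>y\<in>X. m x y = e \<and> m y x = e \<longrightarrow> x = y"
    unfolding L_algebra_def by blast
  have "fin_reg_L_algebra X m e"
  proof
    show "m x y \<in> X" if "x \<in> X" "y \<in> X" for x y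
      using A(2) that unfolding L_algebra_def by blast
    show "m (m (m x y) z) (m (m y x) z) = m (m (m x y) z) z"
      if "x \<in> X" "y \<in> X" "z \<in> X" for x y z
      using A(3) that unfolding semiregular_def by blast
    show "\<exists>z\<in>X. m x z = e \<and> m z x = y" if "x \<in> X" "y \<in> X" "m x y = e" for x y
      using reg that unfolding natural_le_iff[OF e(1)] by blast
  qed (use A(1) e in \<open>unfold logical_unit_def, blast+\<close>)
  then show "\<exists>e. fin_reg_L_algebra X m e" ..
next
  assume "\<exists>e. fin_reg_L_algebra X m e"
  then obtain e where "fin_reg_L_algebra X m e" ..
  then interpret fin_reg_L_algebra X m e .
  have u: "logical_unit X m e" unfolding logical_unit_def by simp
  have "L_algebra X m"
    unfolding L_algebra_def using closed u cycl antisym by (intro conjI exI[of _ e]) blast+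
  moreover have "regular X m"
    unfolding regular_def semiregular_def natural_le_iff[OF u] using semireg reg by blast
  ultimately show "(X, m) \<in> finite_regular_L_algebras"
    using fin by (simp add: finite_regular_L_algebras_def)
qed

section \<open>Order, up-sets and finiteness\<close>

context fin_reg_L_algebra
begin

text \<open>Semiregularity with \<open>e\<close> as second argument collapses to
  \<open>z \<cdot> (x \<cdot> z) = z \<cdot> z\<close>.\<close>

lemma le_mult: "x \<in> X \<Longrightarrow> z \<in> X \<Longrightarrow> z \<cdot> (x \<cdot> z) = e"
  using semireg[of x e z] by simp

lemma le_trans:
  assumes "x \<in> X" "y \<in> X" "z \<in> X" "x \<cdot> y = e" "y \<cdot> z = e"
  shows "x \<cdot> z = e"
  using cycl[of x y z] assms by simp

lemma mult_mono: "x \<in> X \<Longrightarrow> y \<in> X \<Longrightarrow> z \<in> X \<Longrightarrow> y \<cdot> z = e \<Longrightarrow> (x \<cdot> y) \<cdot> (x \<cdot> z) = e"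
  using cycl[of x y z] by simp

definition up :: "'a \<Rightarrow> 'a set" where
  "up x = {y \<in> X. x \<cdot> y = e}"

lemma finite_up: "finite (up x)"
  using fin by (simp add: up_def)

text \<open>The size of the up-set is the measure of all later inductions over elements, which
  therefore run upwards towards the unit.\<close>

lemma card_up_less:
  assumes "x \<in> X" "y \<in> X" "x \<cdot> y = e" "x \<noteq> y"
  shows "card (up y) < card (up x)"
proof (rule psubset_card_mono[OF finite_up])
  have "x \<notin> up y" using assms antisym[of x y] by (auto simp: up_def)
  moreover have "x \<in> up x" using assms by (simp add: up_def)
  moreover have "up y \<subseteq> up x" using assms le_trans[of x y] unfolding up_def by blast
  ultimately show "up y \<subset> up x" by blast
qed

text \<open>Regularity puts \<open>up x\<close> inside its own image under this map; for a finite
  set this forces injectivity.\<close>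

lemma inj_on_up:
  assumes "x \<in> X"
  shows "inj_on (\<lambda>z. z \<cdot> x) (up x)"
proof (rule finite_surj_inj[OF finite_up])
  show "up x \<subseteq> (\<lambda>z. z \<cdot> x) ` up x"
    using reg[OF assms] by (fastforce simp: up_def)
qed

text \<open>If \<open>a \<cdot> x = x = e \<cdot> x\<close>, then injectivity on
  \<open>up x\<close>, which contains both \<open>a\<close> and \<open>e\<close>, would give
  \<open>a = e\<close>.\<close>

lemma less_mult:
  assumes "x \<in> X" "a \<in> X" "x \<cdot> a = e" "a \<noteq> e"
  shows "card (up (a \<cdot> x)) < card (up x)"
proof (rule card_up_less)
  show "x \<noteq> a \<cdot> x"
  proof
    assume "x = a \<cdot> x"
    then have "a \<cdot> x = e \<cdot> x" using assms by simp
    then show False using inj_on_up[OF assms(1)] assms by (auto simp: inj_on_def up_def)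
  qed
qed (use assms le_mult in auto)

section \<open>Coatoms, their action and their multiplicities\<close>

definition coatom :: "'a \<Rightarrow> bool" where
  "coatom a \<longleftrightarrow> a \<in> X \<and> a \<noteq> e \<and> (\<forall>y\<in>X. a \<cdot> y = e \<longrightarrow> y = a \<or> y = e)"

lemma coatom_in [simp]: "coatom a \<Longrightarrow> a \<in> X"
  by (simp add: coatom_def)

lemma coatom_neq: "coatom a \<Longrightarrow> a \<noteq> e"
  unfolding coatom_def by blast

text \<open>By \<open>le_mult\<close> the product lies above \<open>a\<close>, so it can only be
  \<open>a\<close> or \<open>e\<close>.\<close>

lemma mult_coatom:
  assumes "coatom a" "y \<in> X" "y \<cdot> a \<noteq> e"
  shows "y \<cdot> a = a"
  using assms le_mult[of y a] unfolding coatom_def by auto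

lemma coatom_mult_coatom:
  assumes "coatom a" "coatom b" "a \<noteq> b"
  shows "a \<cdot> b = b"
  using assms mult_coatom[of b a] unfolding coatom_def by metis

lemma ex_coatom:
  assumes "x \<in> X" "x \<noteq> e"
  shows "\<exists>a. coatom a \<and> x \<cdot> a = e"
  using assms
proof (induction "card (up x)" arbitrary: x rule: less_induct)
  case less
  show ?case
  proof (cases "coatom x")
    case True
    then show ?thesis using less.prems self by blast
  next
    case False
    then obtain y where y: "y \<in> X" "x \<cdot> y = e" "y \<noteq> x" "y \<noteq> e"
      using less.prems unfolding coatom_def by blast
    then obtain a where "coatom a" "y \<cdot> a = e"
      using less.hyps[of y] card_up_less[of x y] less.prems by blast
    then show ?thesis using le_trans[of x y a] y less.prems by auto
  qed
qed

text \<open>By \<open>le_mult\<close>, \<open>y\<close> lies below \<open>a \<cdot> y\<close>. The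
  reverse inequality comes from semiregularity, applied to \<open>a\<close> and an element
  \<open>z\<close> above \<open>y\<close> that acts on \<open>y\<close> as \<open>a\<close>
  does.\<close>

lemma coatom_mult_absorb:
  assumes "coatom a" "y \<in> X" "y \<cdot> a \<noteq> e"
  shows "a \<cdot> y = y"
  using assms(2,3)
proof (induction "card (up y)" arbitrary: y rule: less_induct)
  case less
  note a = \<open>coatom a\<close> and y = less.prems
  have y_le: "y \<cdot> (a \<cdot> y) = e" using a y by (simp add: le_mult)
  obtain z where z: "z \<in> X" "y \<cdot> z = e" "z \<cdot> y = a \<cdot> y"
    using reg[of y "a \<cdot> y"] a y y_le by auto
  show ?case
  proof (cases "z = y")
    case True
    then have "a \<cdot> y = e" using z y by simp
    then have "y = e" using a y unfolding coatom_def by fastforce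
    then show ?thesis using a by simp
  next
    case False
    have za: "z \<cdot> a \<noteq> e" using le_trans[of y z a] a y z by auto
    have "a \<cdot> z = z" using less.hyps[of z] card_up_less[of y z] False y z za by auto
    moreover have "z \<cdot> a = a" using mult_coatom a z(1) za by blast
    \<comment> \<open>With \<open>z \<cdot> a = a\<close> and \<open>a \<cdot> z = z\<close>,
      semiregularity at \<open>z\<close>, \<open>a\<close>, \<open>y\<close> reads like this; its
      left side is \<open>e\<close> by the choice of \<open>z\<close>.\<close>
    ultimately have "(a \<cdot> y) \<cdot> (z \<cdot> y) = (a \<cdot> y) \<cdot> y"
      using semireg[of z a y] a y z by simp
    then have "(a \<cdot> y) \<cdot> y = e" using z a y by simp
    then show ?thesis using antisym y_le a y by simp
  qed
qed

text \<open>In a Young diagram, where \<open>a\<close> is a negative unit vector, this is the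
  negated coordinate of \<open>x\<close> in that direction. The minimum exists for coatoms by
  \<open>ex_iterate_not_le\<close>.\<close>

definition mult :: "'a \<Rightarrow> 'a \<Rightarrow> nat" where
  "mult a x = (LEAST n. (((\<cdot>) a) ^^ n) x \<cdot> a \<noteq> e)"

lemma iterate_in [simp]: "a \<in> X \<Longrightarrow> x \<in> X \<Longrightarrow> (((\<cdot>) a) ^^ n) x \<in> X"
  by (induction n) auto

text \<open>As long as an iterate stays below \<open>a\<close>, \<open>less_mult\<close> makes the
  next one strictly larger, which cannot go on forever.\<close>

lemma ex_iterate_not_le:
  assumes "coatom a" "x \<in> X"
  shows "\<exists>n. (((\<cdot>) a) ^^ n) x \<cdot> a \<noteq> e"
  using assms(2)
proof (induction "card (up x)" arbitrary: x rule: less_induct)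
  case less
  show ?case
  proof (cases "x \<cdot> a = e")
    case True
    have "card (up (a \<cdot> x)) < card (up x)"
      using less_mult True assms(1) less.prems unfolding coatom_def by blast
    then obtain n where "(((\<cdot>) a) ^^ n) (a \<cdot> x) \<cdot> a \<noteq> e"
      using less.hyps[of "a \<cdot> x"] assms(1) less.prems by auto
    then have "(((\<cdot>) a) ^^ Suc n) x \<cdot> a \<noteq> e" by (simp add: funpow_swap1)
    then show ?thesis by blast
  next
    case False
    then show ?thesis by (intro exI[of _ 0]) simp
  qed
qed

lemma mult_eq_0_iff:
  assumes "coatom a" "x \<in> X"
  shows "mult a x = 0 \<longleftrightarrow> x \<cdot> a \<noteq> e"
proof
  assume "mult a x = 0"
  then show "x \<cdot> a \<noteq> e"
    using LeastI_ex[OF ex_iterate_not_le[OF assms]] unfolding mult_def by simp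
next
  assume "x \<cdot> a \<noteq> e"
  then show "mult a x = 0" unfolding mult_def by (intro Least_eq_0) simp
qed

lemma mult_Suc:
  assumes "coatom a" "x \<in> X" "x \<cdot> a = e"
  shows "mult a x = Suc (mult a (a \<cdot> x))"
proof -
  obtain n where "(((\<cdot>) a) ^^ n) x \<cdot> a \<noteq> e" using ex_iterate_not_le[OF assms(1,2)] by blast
  \<comment> \<open>Index 0 fails because \<open>x\<close> is below \<open>a\<close>, so the least
    index is a successor.\<close>
  then have "mult a x = Suc (LEAST n. (((\<cdot>) a) ^^ Suc n) x \<cdot> a \<noteq> e)"
    unfolding mult_def by (rule Least_Suc) (use assms in simp)
  then show ?thesis by (simp add: mult_def funpow_swap1)
qed

text \<open>This is \<open>cycl\<close> at \<open>a\<close>, \<open>b\<close>, \<open>x\<close>,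
  since distinct coatoms satisfy \<open>a \<cdot> b = b\<close> and
  \<open>b \<cdot> a = a\<close>.\<close>

lemma coatoms_commute:
  assumes "coatom a" "coatom b" "a \<noteq> b" "x \<in> X"
  shows "b \<cdot> (a \<cdot> x) = a \<cdot> (b \<cdot> x)"
  using cycl[of a b x] assms coatom_mult_coatom[of a b] coatom_mult_coatom[of b a] by simp

lemma mult_other:
  assumes "coatom a" "coatom b" "a \<noteq> b" "x \<in> X"
  shows "mult b (a \<cdot> x) = mult b x"
proof -
  have iter: "(((\<cdot>) b) ^^ n) (a \<cdot> x) = a \<cdot> (((\<cdot>) b) ^^ n) x" for n
  proof (induction n)
    case (Suc n)
    then show ?case using coatoms_commute[OF assms(1-3), of "(((\<cdot>) b) ^^ n) x"] assms by simp
  qed simp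
  \<comment> \<open>One direction holds because \<open>y\<close> is below
    \<open>a \<cdot> y\<close>, the other by monotonicity and
    \<open>a \<cdot> b = b\<close>.\<close>
  have "(a \<cdot> y) \<cdot> b = e \<longleftrightarrow> y \<cdot> b = e" if "y \<in> X" for y
    using le_trans[of y "a \<cdot> y" b] le_mult[of a y] mult_mono[of a y b]
      coatom_mult_coatom[of a b] assms that by auto
  then show ?thesis using assms(2,4) unfolding mult_def iter by simp
qed

text \<open>Joins \<open>mult_Suc\<close> and \<open>mult_other\<close>; integers keep the
  subtraction from being truncated.\<close>

lemma mult_coatom_step:
  assumes "coatom a" "coatom b" "x \<in> X" "x \<cdot> a = e"
  shows "int (mult b (a \<cdot> x)) = int (mult b x) - (if b = a then 1 else 0)"
  using mult_Suc[of a x] mult_other[of a b x] assms by auto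

text \<open>Equal multiplicities put \<open>x\<close> and \<open>y\<close> below the same coatoms,
  so a common coatom can be stripped from both.\<close>

lemma mult_inject:
  assumes "x \<in> X" "y \<in> X" "\<And>a. coatom a \<Longrightarrow> mult a x = mult a y"
  shows "x = y"
  using assms
proof (induction "card (up x)" arbitrary: x y rule: less_induct)
  case less
  have le_iff: "x \<cdot> a = e \<longleftrightarrow> y \<cdot> a = e" if "coatom a" for a
    using less.prems mult_eq_0_iff[OF that] that by metis
  show ?case
  proof (cases "x = e")
    case True
    have "y = e"
    proof (rule ccontr)
      assume "y \<noteq> e"
      then obtain a where "coatom a" "e \<cdot> a = e"
        using ex_coatom[of y] le_iff less.prems True by blast
      then show False using coatom_neq by simp
    qed
    then show ?thesis using True by simp
  next
    case False
    then obtain a where a: "coatom a" "x \<cdot> a = e" using ex_coatom less.prems by blast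
    then have y: "y \<cdot> a = e" using le_iff by blast
    have "a \<cdot> x = a \<cdot> y"
    proof (rule less.hyps)
      show "card (up (a \<cdot> x)) < card (up x)"
        using less_mult a less.prems unfolding coatom_def by blast
      show "mult b (a \<cdot> x) = mult b (a \<cdot> y)" if "coatom b" for b
        using mult_coatom_step[of a b x] mult_coatom_step[of a b y] that a y less.prems by simp
    qed (use a less.prems in auto)
    \<comment> \<open>When both elements are below \<open>a\<close>, \<open>cycl\<close> shows that
      stripping \<open>a\<close> does not change their products, so equality lifts back by
      antisymmetry.\<close>
    moreover have "x \<cdot> y = (a \<cdot> x) \<cdot> (a \<cdot> y)" "y \<cdot> x = (a \<cdot> y) \<cdot> (a \<cdot> x)"
      using cycl[of a x y] cycl[of a y x] a y less.prems(1,2) by simp_all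
    ultimately have "x \<cdot> y = e" "y \<cdot> x = e" using a less.prems(1,2) by simp_all
    then show ?thesis using antisym less.prems(1,2) by blast
  qed
qed

lemma mult_unit: "coatom a \<Longrightarrow> mult a e = 0"
  by (simp add: mult_eq_0_iff coatom_neq)

text \<open>Truncated subtraction of naturals is \<open>cone_op\<close> on their negatives, so this
  makes negated multiplicities a homomorphism. The proof strips a coatom above \<open>x\<close> from
  both arguments.\<close>

lemma mult_mult:
  assumes "x \<in> X" "y \<in> X" "coatom b"
  shows "mult b (x \<cdot> y) = mult b y - mult b x"
  using assms
proof (induction "card (up x)" arbitrary: x y rule: less_induct)
  case less
  show ?case
  proof (cases "x = e")
    case True
    then show ?thesis using less.prems by (simp add: mult_unit)
  next
    case False
    then obtain a where a: "coatom a" "x \<cdot> a = e" using ex_coatom less.prems by blast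
    have "card (up (a \<cdot> x)) < card (up x)"
      using less_mult a less.prems unfolding coatom_def by blast
    then have IH: "mult b ((a \<cdot> x) \<cdot> (a \<cdot> y)) = mult b (a \<cdot> y) - mult b (a \<cdot> x)"
      using less.hyps[of "a \<cdot> x" "a \<cdot> y"] less.prems a by simp
    have xy: "(a \<cdot> x) \<cdot> (a \<cdot> y) = x \<cdot> y"
      using cycl[of a x y] a less.prems by simp
    show ?thesis
    proof (cases "y \<cdot> a = e")
      case True
      show ?thesis
        using IH xy mult_coatom_step[of a b x] mult_coatom_step[of a b y] a less.prems True
        by (auto split: if_splits)
    next
      case False
      \<comment> \<open>Here \<open>a\<close> fixes \<open>y\<close> and has multiplicity 0 in it,
        so lowering its multiplicity in \<open>x\<close> leaves the truncated difference at
        0.\<close>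
      then show ?thesis
        using IH xy mult_coatom_step[of a b x] a less.prems coatom_mult_absorb[of a y]
          mult_eq_0_iff[of a y]
        by (auto split: if_splits)
    qed
  qed
qed

text \<open>This becomes the upward closure of the embedded algebra: wherever a multiplicity is too
  large, acting with that coatom lowers it alone by one.\<close>

lemma ex_mult_eq:
  assumes "x \<in> X" "\<And>a. coatom a \<Longrightarrow> k a \<le> mult a x"
  shows "\<exists>y\<in>X. \<forall>a. coatom a \<longrightarrow> mult a y = k a"
  using assms
proof (induction "card (up x)" arbitrary: x rule: less_induct)
  case less
  show ?case
  proof (cases "\<forall>a. coatom a \<longrightarrow> mult a x = k a")
    case True
    then show ?thesis using less.prems by blast
  next
    case False
    then obtain a where a: "coatom a" "k a < mult a x"
      using less.prems(2) order.not_eq_order_implies_strict by metis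
    then have xa: "x \<cdot> a = e" using mult_eq_0_iff[of a x] less.prems(1) by auto
    show ?thesis
    proof (rule less.hyps)
      show "card (up (a \<cdot> x)) < card (up x)"
        using less_mult a xa less.prems unfolding coatom_def by blast
      show "k b \<le> mult b (a \<cdot> x)" if "coatom b" for b
        using mult_coatom_step[of a b x] less.prems a xa that
        by (cases "b = a") fastforce+
    qed (use a less.prems in auto)
  qed
qed

end

section \<open>Young diagrams as L-algebras\<close>

lemma cone_op_apply: "cone_op x y i = min (x i) (y i) - x i"
  by (simp add: cone_op_def inf_min)

lemma neg_cone_le_0: "x \<in> neg_cone \<Longrightarrow> x i \<le> 0"
  by (simp add: neg_cone_def)

text \<open>Squeezed between \<open>x\<close> and 0, \<open>y\<close> vanishes wherever
  \<open>x\<close> does, so its support stays finite.\<close>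

lemma neg_coneI:
  assumes "x \<in> neg_cone" "\<And>i. x i \<le> y i" "\<And>i. y i \<le> 0"
  shows "y \<in> neg_cone"
proof -
  have "y i = 0" if "x i = 0" for i using assms(2,3)[of i] that by linarith
  then have "{i. y i \<noteq> 0} \<subseteq> {i. x i \<noteq> 0}" by blast
  then show ?thesis
    using assms finite_subset unfolding neg_cone_def Z_omega_def by blast
qed

lemma young_diagram_upI:
  assumes "Y \<in> young_diagrams" "x \<in> Y" "\<And>i. x i \<le> y i" "\<And>i. y i \<le> 0"
  shows "y \<in> Y"
proof -
  have "x \<in> neg_cone" using assms by (auto simp: young_diagrams_def)
  then have "y \<in> neg_cone" using neg_coneI assms(3,4) by blast
  then show ?thesis using assms by (auto simp: young_diagrams_def le_fun_def)
qed

lemma young_diagram_le_0: "Y \<in> young_diagrams \<Longrightarrow> x \<in> Y \<Longrightarrow> x i \<le> 0"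
  by (auto simp: young_diagrams_def neg_cone_def)

lemma young_diagram_zero: "Y \<in> young_diagrams \<Longrightarrow> (\<lambda>i. 0) \<in> Y"
  using young_diagram_upI[of Y _ "\<lambda>i. 0"] young_diagram_le_0[of Y]
  by (auto simp: young_diagrams_def)

text \<open>Since \<open>x\<close> is nonpositive, the result lies between \<open>y\<close> and 0,
  and upward closure applies.\<close>

lemma cone_op_closed:
  assumes Y: "Y \<in> young_diagrams" and "x \<in> Y" "y \<in> Y"
  shows "cone_op x y \<in> Y"
proof (rule young_diagram_upI[OF Y \<open>y \<in> Y\<close>])
  fix i
  show "y i \<le> cone_op x y i" "cone_op x y i \<le> 0"
    using young_diagram_le_0[OF Y, of x i] young_diagram_le_0[OF Y, of y i] assms
    by (auto simp: cone_op_apply)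
qed

lemma cone_op_eq_0_iff: "cone_op x y = (\<lambda>i. 0) \<longleftrightarrow> (\<forall>i. x i \<le> y i)"
  by (auto simp: fun_eq_iff cone_op_apply min_def)

lemma fin_reg_young_diagram:
  assumes Y: "Y \<in> young_diagrams"
  shows "fin_reg_L_algebra Y cone_op (\<lambda>i. 0)"
proof
  note le0 = young_diagram_le_0[OF Y]
  show "finite Y" using Y by (simp add: young_diagrams_def)
  show "cone_op x y \<in> Y" if "x \<in> Y" "y \<in> Y" for x y
    using cone_op_closed[OF Y that] .
  show "(\<lambda>i. 0) \<in> Y" using young_diagram_zero[OF Y] .
  show "cone_op (\<lambda>i. 0) x = x" if "x \<in> Y" for x
    using le0[OF that] by (auto simp: fun_eq_iff cone_op_apply min_def intro: antisym)
  show "cone_op x (\<lambda>i. 0) = (\<lambda>i. 0)" if "x \<in> Y" for x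
    using le0[OF that] by (simp add: cone_op_eq_0_iff)
  show "cone_op x x = (\<lambda>i. 0)" for x by (simp add: cone_op_eq_0_iff)
  show "cone_op (cone_op x y) (cone_op x z) = cone_op (cone_op y x) (cone_op y z)" for x y z
    by (auto simp: fun_eq_iff cone_op_apply min_def)
  show "x = y" if "cone_op x y = (\<lambda>i. 0)" "cone_op y x = (\<lambda>i. 0)" for x y
    using that unfolding cone_op_eq_0_iff by (auto intro!: ext order.antisym)
  show "cone_op (cone_op (cone_op x y) z) (cone_op (cone_op y x) z) =
        cone_op (cone_op (cone_op x y) z) z" if "x \<in> Y" "y \<in> Y" "z \<in> Y" for x y z
  proof
    fix i
    show "cone_op (cone_op (cone_op x y) z) (cone_op (cone_op y x) z) i =
        cone_op (cone_op (cone_op x y) z) z i"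
      using le0[OF that(1), of i] le0[OF that(2), of i] le0[OF that(3), of i]
      by (auto simp: cone_op_apply min_def)
  qed
  show "\<exists>z\<in>Y. cone_op x z = (\<lambda>i. 0) \<and> cone_op z x = y"
    if "x \<in> Y" "y \<in> Y" "cone_op x y = (\<lambda>i. 0)" for x y
  proof (intro bexI conjI)
    have le: "x i \<le> y i" "y i \<le> 0" for i using that le0 by (auto simp: cone_op_eq_0_iff)
    \<comment> \<open>The regularity witness is \<open>x - y\<close>: it lies between
      \<open>x\<close> and 0, and \<open>x - (x - y) = y\<close> is already nonpositive, so the
      minimum with 0 leaves it alone.\<close>
    show "x - y \<in> Y"
      by (rule young_diagram_upI[OF Y that(1)]) (use le in auto)
    show "cone_op x (x - y) = (\<lambda>i. 0)" using le by (simp add: cone_op_eq_0_iff)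
    show "cone_op (x - y) x = y" using le by (simp add: fun_eq_iff cone_op_apply min_absorb2)
  qed
qed

section \<open>Every finite regular L-algebra is a Young diagram\<close>

lemma (in fin_reg_L_algebra) isomorphic_young_diagram:
  "\<exists>Y\<in>young_diagrams. L_isomorphic (X, m) (Y, cone_op)"
proof -
  define C where "C = {a. coatom a}"
  have finC: "finite C" using fin unfolding C_def by (rule rev_finite_subset) auto
  \<comment> \<open>\<open>\<iota>\<close> assigns a coordinate to each coatom;
    \<open>\<phi>\<close> below is 0 on all other coordinates, which gives finite support.\<close>
  then obtain \<iota> :: "'a \<Rightarrow> nat" where inj: "inj_on \<iota> C"
    using finite_imp_inj_to_nat_seg by metis
  define \<phi> where "\<phi> x = (\<lambda>j. if j \<in> \<iota> ` C then - int (mult (inv_into C \<iota> j) x) else 0)" for x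
  have \<phi>_coord: "\<phi> x (\<iota> a) = - int (mult a x)" if "coatom a" for x a
    using that inj by (auto simp: \<phi>_def C_def)
  have \<phi>_out: "\<phi> x j = 0" if "j \<notin> \<iota> ` C" for x j
    using that by (simp add: \<phi>_def)
  have eqI: "f = g" if "\<And>a. coatom a \<Longrightarrow> f (\<iota> a) = g (\<iota> a)" "\<And>j. j \<notin> \<iota> ` C \<Longrightarrow> f j = g j"
    for f g :: "nat \<Rightarrow> int"
  proof
    fix j
    show "f j = g j"
      by (cases "j \<in> \<iota> ` C") (use that in \<open>auto simp: C_def\<close>)
  qed
  have hom: "\<phi> (x \<cdot> y) = cone_op (\<phi> x) (\<phi> y)" if "x \<in> X" "y \<in> X" for x y
    by (rule eqI) (use that in \<open>auto simp: \<phi>_coord \<phi>_out cone_op_apply mult_mult\<close>)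
  have inj_\<phi>: "inj_on \<phi> X"
  proof (rule inj_onI)
    fix x y assume xy: "x \<in> X" "y \<in> X" "\<phi> x = \<phi> y"
    have "mult a x = mult a y" if "coatom a" for a
      using \<phi>_coord[OF that, of x] \<phi>_coord[OF that, of y] xy by simp
    then show "x = y" using mult_inject xy by blast
  qed
  have "\<phi> ` X \<subseteq> neg_cone"
  proof -
    have "finite {i. \<phi> x i \<noteq> 0}" for x
      by (rule finite_subset[of _ "\<iota> ` C"]) (use \<phi>_out finC in auto)
    then show ?thesis by (auto simp: neg_cone_def Z_omega_def \<phi>_def)
  qed
  moreover have "g \<in> \<phi> ` X" if x: "x \<in> X" and g: "g \<in> neg_cone" "\<phi> x \<le> g" for x g
  proof -
    have g_le: "g i \<le> 0" "\<phi> x i \<le> g i" for i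
      using g by (auto simp: neg_cone_le_0 le_fun_def)
    \<comment> \<open>Lying above \<open>\<phi> x\<close> bounds the multiplicities prescribed by
      \<open>g\<close>, so \<open>ex_mult_eq\<close> supplies a preimage of
      \<open>g\<close>.\<close>
    have "nat (- g (\<iota> a)) \<le> mult a x" if "coatom a" for a
      using g_le(2)[of "\<iota> a"] \<phi>_coord[OF that, of x] by simp
    then obtain y where y: "y \<in> X" "\<forall>a. coatom a \<longrightarrow> mult a y = nat (- g (\<iota> a))"
      using ex_mult_eq[OF x, of "\<lambda>a. nat (- g (\<iota> a))"] by blast
    have "\<phi> y = g"
    proof (rule eqI)
      show "\<phi> y (\<iota> a) = g (\<iota> a)" if "coatom a" for a
        using \<phi>_coord[OF that, of y] y(2) that g_le(1)[of "\<iota> a"] by simp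
      show "\<phi> y j = g j" if "j \<notin> \<iota> ` C" for j
        \<comment> \<open>Off the coatom coordinates \<open>g\<close> is squeezed between
          \<open>\<phi> x\<close>, which is 0 there, and 0.\<close>
        using \<phi>_out[OF that] g_le[of j] by (metis order.antisym)
    qed
    then show ?thesis using y(1) by blast
  qed
  moreover have "\<phi> ` X \<noteq> {}" using unit_in by blast
  ultimately have "\<phi> ` X \<in> young_diagrams"
    using fin by (auto simp: young_diagrams_def)
  moreover have "L_isomorphic (X, m) (\<phi> ` X, cone_op)"
    unfolding L_isomorphic_def
    by (rule exI[of _ \<phi>]) (use hom inj_\<phi> in \<open>auto simp: bij_betw_def\<close>)
  ultimately show ?thesis by blast
qed

lemma frla_closed:
  "A \<in> finite_regular_L_algebras \<Longrightarrow> \<forall>x\<in>fst A. \<forall>y\<in>fst A. snd A x y \<in> fst A"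
  by (auto simp: finite_regular_L_algebras_def L_algebra_def)

lemma ex_young_diagram:
  assumes "A \<in> finite_regular_L_algebras"
  shows "\<exists>Y\<in>young_diagrams. L_isomorphic (Y, cone_op) A"
proof -
  obtain e where "fin_reg_L_algebra (fst A) (snd A) e"
    using assms fin_reg_L_algebra_iff[of "fst A" "snd A"] by auto
  then obtain Y where "Y \<in> young_diagrams" "L_isomorphic A (Y, cone_op)"
    using fin_reg_L_algebra.isomorphic_young_diagram by fastforce
  then show ?thesis using L_isomorphic_sym frla_closed[OF assms] by blast
qed

section \<open>Isomorphic Young diagrams are conjugate\<close>

text \<open>These negative unit vectors are the coatoms of the diagrams containing them, see
  \<open>young_diagram_coatom_iff\<close>.\<close>

definition coord :: "nat \<Rightarrow> nat \<Rightarrow> int" where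
  "coord i = (\<lambda>j. if j = i then - 1 else 0)"

lemma coord_self [simp]: "coord i i = - 1" by (simp add: coord_def)

lemma coord_inject: "coord i = coord j \<longleftrightarrow> i = j"
  by (auto simp: coord_def fun_eq_iff split: if_splits)

text \<open>By \<open>coord_in_young_diagram\<close> these are the coordinates on which some member
  of \<open>Y\<close> is nonzero.\<close>

definition support :: "(nat \<Rightarrow> int) set \<Rightarrow> nat set" where
  "support Y = {i. coord i \<in> Y}"

lemma coord_in_young_diagram:
  assumes "Y \<in> young_diagrams" "x \<in> Y" "x i < 0"
  shows "coord i \<in> Y"
  by (rule young_diagram_upI[OF assms(1,2)])
    (use assms young_diagram_le_0[OF assms(1,2)] in \<open>auto simp: coord_def\<close>)

lemma finite_support:
  assumes "Y \<in> young_diagrams"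
  shows "finite (support Y)"
proof (rule inj_on_finite[of coord])
  show "inj_on coord (support Y)" by (auto simp: inj_on_def coord_inject)
  show "coord ` support Y \<subseteq> Y" by (auto simp: support_def)
  show "finite Y" using assms by (simp add: young_diagrams_def)
qed

text \<open>The right side mentions only the unit and the operation, so an isomorphism of diagrams
  carries unit vectors to unit vectors.\<close>

lemma young_diagram_coatom_iff:
  assumes Y: "Y \<in> young_diagrams" and "y \<in> Y"
  shows "(\<exists>i. y = coord i) \<longleftrightarrow>
    y \<noteq> (\<lambda>i. 0) \<and> (\<forall>z\<in>Y. cone_op y z = (\<lambda>i. 0) \<longrightarrow> z = y \<or> z = (\<lambda>i. 0))" (is "?L \<longleftrightarrow> ?R")
proof
  assume ?L
  then obtain i where i: "y = coord i" ..
  have "z = y \<or> z = (\<lambda>i. 0)" if "z \<in> Y" "\<forall>j. y j \<le> z j" for z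
  proof -
    have "z j = 0" if "j \<noteq> i" for j
      using young_diagram_le_0[OF Y \<open>z \<in> Y\<close>, of j] \<open>\<forall>j. y j \<le> z j\<close>[rule_format, of j] that
      by (simp add: i coord_def)
    moreover have "z i = 0 \<or> z i = - 1"
      using young_diagram_le_0[OF Y \<open>z \<in> Y\<close>, of i] \<open>\<forall>j. y j \<le> z j\<close>[rule_format, of i]
      by (auto simp: i)
    ultimately show ?thesis unfolding i coord_def fun_eq_iff by metis
  qed
  moreover have "y \<noteq> (\<lambda>i. 0)"
    unfolding i coord_def fun_eq_iff by (metis neg_equal_0_iff_equal zero_neq_one)
  ultimately show ?R by (simp add: cone_op_eq_0_iff)
next
  assume R: ?R
  then obtain i where "y i \<noteq> 0" by (auto simp: fun_eq_iff)
  then have i: "y i < 0" using young_diagram_le_0[OF assms, of i] by simp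
  then have "coord i \<in> Y" using coord_in_young_diagram assms by blast
  moreover have "cone_op y (coord i) = (\<lambda>i. 0)"
    using i young_diagram_le_0[OF assms] by (auto simp: cone_op_eq_0_iff coord_def)
  moreover have "coord i \<noteq> (\<lambda>i. 0)"
    unfolding coord_def fun_eq_iff by (metis neg_equal_0_iff_equal zero_neq_one)
  ultimately show ?L using R by metis
qed

lemma iso_conjugate:
  assumes Y: "Y \<in> young_diagrams" and Z: "Z \<in> young_diagrams"
    and bij: "bij_betw f Y Z"
    and hom: "\<And>x y. x \<in> Y \<Longrightarrow> y \<in> Y \<Longrightarrow> f (cone_op x y) = cone_op (f x) (f y)"
  shows "(Y, Z) \<in> conj_rel"
proof -
  let ?O = "(\<lambda>i. 0) :: nat \<Rightarrow> int"
  interpret Y: fin_reg_L_algebra Y cone_op ?O by (rule fin_reg_young_diagram[OF Y])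
  interpret Z: fin_reg_L_algebra Z cone_op ?O by (rule fin_reg_young_diagram[OF Z])
  have fZ: "f y \<in> Z" if "y \<in> Y" for y using that bij by (auto simp: bij_betw_def)
  have inj: "f x = f y \<longleftrightarrow> x = y" if "x \<in> Y" "y \<in> Y" for x y
    using that bij by (auto simp: bij_betw_def inj_on_def)
  have img: "Z = f ` Y" using bij by (simp add: bij_betw_def)
  have f0: "f ?O = ?O" using hom[of ?O ?O] fZ by simp
  have le_iff: "cone_op (f x) (f y) = ?O \<longleftrightarrow> cone_op x y = ?O" if "x \<in> Y" "y \<in> Y" for x y
    using hom[OF that] inj[of "cone_op x y" ?O] that f0 by simp
  have coatom_iff: "(\<exists>j. f y = coord j) \<longleftrightarrow> (\<exists>i. y = coord i)" if y: "y \<in> Y" for y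
    unfolding young_diagram_coatom_iff[OF Y y] young_diagram_coatom_iff[OF Z fZ[OF y]] img
    using le_iff[OF y] inj[OF _ y] inj[of _ ?O] inj[OF y, of ?O] f0 by auto
  have "\<forall>i\<in>support Y. \<exists>j. f (coord i) = coord j"
    using coatom_iff by (auto simp: support_def)
  \<comment> \<open>The action of \<open>f\<close> on coatoms, read as a map of coordinates.\<close>
  then obtain \<sigma> where \<sigma>: "\<And>i. i \<in> support Y \<Longrightarrow> f (coord i) = coord (\<sigma> i)"
    by metis
  have "inj_on \<sigma> (support Y)"
  proof (rule inj_onI)
    fix i j assume "i \<in> support Y" "j \<in> support Y" "\<sigma> i = \<sigma> j"
    then show "i = j"
      using \<sigma>[of i] \<sigma>[of j] inj[of "coord i" "coord j"] by (simp add: support_def coord_inject)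
  qed
  moreover have "\<sigma> ` support Y = support Z"
  proof
    show "\<sigma> ` support Y \<subseteq> support Z"
    proof (clarify)
      fix i assume "i \<in> support Y"
      then show "\<sigma> i \<in> support Z" using \<sigma>[of i] fZ[of "coord i"] by (simp add: support_def)
    qed
    show "support Z \<subseteq> \<sigma> ` support Y"
    proof
      fix j assume "j \<in> support Z"
      then obtain y where y: "y \<in> Y" "f y = coord j" using img by (auto simp: support_def)
      then obtain i where "y = coord i" using coatom_iff by blast
      then have "i \<in> support Y" "\<sigma> i = j"
        using y \<sigma>[of i] by (auto simp: support_def coord_inject)
      then show "j \<in> \<sigma> ` support Y" by blast
    qed
  qed
  ultimately have \<sigma>_bij: "bij_betw \<sigma> (support Y) (support Z)" by (simp add: bij_betw_def)
  obtain \<tau> where \<tau>: "bij \<tau>" "\<And>i. i \<in> support Y \<Longrightarrow> \<tau> i = \<sigma> i"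
  proof -
    let ?S = "support Y \<union> support Z"
    have fS: "finite (support Y)" "finite (support Z)" using finite_support Y Z by auto
    have "card (support Y) = card (support Z)" using \<sigma>_bij by (rule bij_betw_same_card)
    \<comment> \<open>To extend \<open>\<sigma>\<close> to a permutation of all coordinates, the
      rest of the finite union \<open>?S\<close> is matched by counting, and everything outside is
      fixed.\<close>
    then have "card (?S - support Y) = card (?S - support Z)"
      using fS by (simp add: card_Diff_subset)
    then obtain \<rho> where \<rho>: "bij_betw \<rho> (?S - support Y) (?S - support Z)"
      using fS finite_same_card_bij by (metis finite_Diff finite_Un)
    let ?t = "\<lambda>i. if i \<in> support Y then \<sigma> i else if i \<in> ?S - support Y then \<rho> i else i"
    have "bij_betw ?t (support Y \<union> (?S - support Y) \<union> - ?S) (support Z \<union> (?S - support Z) \<union> - ?S)"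
    proof (intro bij_betw_combine)
      show "bij_betw ?t (support Y) (support Z)"
        using \<sigma>_bij by (rule iffD1[OF bij_betw_cong, rotated]) auto
      show "bij_betw ?t (?S - support Y) (?S - support Z)"
        using \<rho> by (rule iffD1[OF bij_betw_cong, rotated]) auto
      show "bij_betw ?t (- ?S) (- ?S)"
        using bij_betw_id by (rule iffD1[OF bij_betw_cong, rotated]) auto
    qed auto
    moreover have "support Y \<union> (?S - support Y) \<union> - ?S = UNIV"
      "support Z \<union> (?S - support Z) \<union> - ?S = UNIV" by auto
    ultimately have "bij ?t" by simp
    then show thesis using that by simp
  qed
  have f_eq: "f x \<circ> \<tau> = x" if "x \<in> Y" for x
    using that
  proof (induction "card (Y.up x)" arbitrary: x rule: less_induct)
    case less
    show ?case
    proof (cases "x = ?O")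
      case True
      then show ?thesis using f0 by auto
    next
      case False
      then obtain i where "x i \<noteq> 0" by (auto simp: fun_eq_iff)
      then have xi: "x i < 0" using young_diagram_le_0[OF Y less.prems, of i] by simp
      then have i: "coord i \<in> Y" using coord_in_young_diagram Y less.prems by blast
      have le: "cone_op x (coord i) = ?O"
        using xi young_diagram_le_0[OF Y less.prems] by (auto simp: cone_op_eq_0_iff coord_def)
      \<comment> \<open>Below \<open>a\<close> the minimum in \<open>cone_op\<close> is inactive, so
        \<open>y\<close> is the sum of \<open>a\<close> and \<open>cone_op a y\<close>. Used for
        \<open>x\<close> with \<open>coord i\<close> and for their images under
        \<open>f\<close>.\<close>
      have split: "y k = a k + cone_op a y k" if "cone_op y a = ?O" for y a :: "nat \<Rightarrow> int" and k
        using that by (simp add: cone_op_eq_0_iff cone_op_apply)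
      have "coord i \<noteq> ?O"
        unfolding coord_def fun_eq_iff by (metis neg_equal_0_iff_equal zero_neq_one)
      then have IH: "f (cone_op (coord i) x) \<circ> \<tau> = cone_op (coord i) x"
        using less.hyps[of "cone_op (coord i) x"] Y.less_mult[OF less.prems i le] less.prems i
        by simp
      have fle: "cone_op (f x) (f (coord i)) = ?O"
        using le_iff[OF less.prems i] le by simp
      have \<tau>i: "f (coord i) = coord (\<tau> i)"
        using \<sigma>[of i] \<tau>(2)[of i] i by (simp add: support_def)
      have "f x (\<tau> k) = x k" for k
      proof -
        have "f x (\<tau> k) = coord (\<tau> i) (\<tau> k) + f (cone_op (coord i) x) (\<tau> k)"
          using split[OF fle, of "\<tau> k"] hom[OF i less.prems] \<tau>i by simp
        also have "coord (\<tau> i) (\<tau> k) = coord i k"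
          using \<tau>(1) by (auto simp: coord_def bij_def inj_def)
        also have "f (cone_op (coord i) x) (\<tau> k) = cone_op (coord i) x k"
          using IH by (metis comp_apply)
        finally show ?thesis using split[OF le, of k] by simp
      qed
      then show ?thesis by auto
    qed
  qed
  \<comment> \<open>Precomposition with \<open>\<tau>\<close> undoes \<open>f\<close>, so it leads
    from \<open>Z\<close> back to \<open>Y\<close>; symmetry of \<open>conj_rel\<close> turns this
    around.\<close>
  have "Y = (\<lambda>g. g \<circ> \<tau>) ` Z"
    unfolding img image_image using f_eq by simp
  then have "(Z, Y) \<in> conj_rel" using Y Z \<tau>(1) unfolding conj_rel_def by blast
  then show ?thesis using equiv_conj_rel by (meson equivE symD)
qed

text \<open>A permutation of coordinates commutes with the pointwise operation; the converse is
  \<open>iso_conjugate\<close>. The two directions make the induced map well defined and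
  injective.\<close>

lemma conj_rel_iff_isomorphic:
  assumes "Y \<in> young_diagrams" "Z \<in> young_diagrams"
  shows "(Y, Z) \<in> conj_rel \<longleftrightarrow> L_isomorphic (Y, cone_op) (Z, cone_op)"
proof
  assume "(Y, Z) \<in> conj_rel"
  then obtain \<pi> where \<pi>: "bij \<pi>" "Z = (\<lambda>g. g \<circ> \<pi>) ` Y" by (auto simp: conj_rel_def)
  have "inj_on (\<lambda>g. g \<circ> \<pi>) Y"
  proof (rule inj_onI)
    fix g h :: "nat \<Rightarrow> int" assume "g \<circ> \<pi> = h \<circ> \<pi>"
    then show "g = h" using surj_fun_eq[OF bij_is_surj[OF \<pi>(1)], of g h] by (auto simp: fun_eq_iff)
  qed
  then have "bij_betw (\<lambda>g. g \<circ> \<pi>) Y Z" using \<pi>(2) by (simp add: bij_betw_def)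
  moreover have "cone_op x y \<circ> \<pi> = cone_op (x \<circ> \<pi>) (y \<circ> \<pi>)" for x y
    by (auto simp: fun_eq_iff cone_op_apply)
  ultimately show "L_isomorphic (Y, cone_op) (Z, cone_op)"
    unfolding L_isomorphic_def by (intro exI[of _ "\<lambda>g. g \<circ> \<pi>"]) simp
next
  assume "L_isomorphic (Y, cone_op) (Z, cone_op)"
  then show "(Y, Z) \<in> conj_rel"
    using iso_conjugate[OF assms] unfolding L_isomorphic_def by auto
qed

section \<open>The correspondence\<close>

text \<open>Transport of structure along an injection, used to move a diagram onto a carrier in
  another type.\<close>

lemma fin_reg_transport:
  assumes "fin_reg_L_algebra X m e" and inj: "inj_on f X"
  defines "m' \<equiv> \<lambda>x y. f (m (inv_into X f x) (inv_into X f y))"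
  shows "fin_reg_L_algebra (f ` X) m' (f e)" and "L_isomorphic (X, m) (f ` X, m')"
proof -
  interpret fin_reg_L_algebra X m e by fact
  have m': "m' (f x) (f y) = f (m x y)" if "x \<in> X" "y \<in> X" for x y
    using that inj by (simp add: m'_def)
  have eq: "f x = f y \<longleftrightarrow> x = y" if "x \<in> X" "y \<in> X" for x y
    using that inj by (auto simp: inj_on_def)
  show "fin_reg_L_algebra (f ` X) m' (f e)"
  \<comment> \<open>Cases 7 to 10 are \<open>cycl\<close>, \<open>antisym\<close>,
    \<open>semireg\<close> and \<open>reg\<close>; each is pulled back to preimages in
    \<open>X\<close>.\<close>
  proof (unfold_locales, goal_cases)
    case (7 x y z)
    then obtain u v w where "x = f u" "y = f v" "z = f w" "u \<in> X" "v \<in> X" "w \<in> X" by auto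
    then show ?case using cycl[of u v w] by (simp add: m')
  next
    case (8 x y)
    then show ?case by (auto simp: m' eq intro: antisym)
  next
    case (9 x y z)
    then obtain u v w where "x = f u" "y = f v" "z = f w" "u \<in> X" "v \<in> X" "w \<in> X" by auto
    then show ?case using semireg[of u v w] by (simp add: m')
  next
    case (10 x y)
    then obtain u v where uv: "x = f u" "y = f v" "u \<in> X" "v \<in> X" by auto
    then have "m u v = e" using 10 by (simp add: m' eq)
    then obtain z where "z \<in> X" "m u z = e" "m z u = v" using reg uv by blast
    then show ?case using uv by (intro bexI[of _ "f z"]) (auto simp: m')
  qed (use fin in \<open>auto simp: m'\<close>)
  show "L_isomorphic (X, m) (f ` X, m')"
    unfolding L_isomorphic_def
    by (rule exI[of _ f]) (use inj m' in \<open>auto simp: bij_betw_def\<close>)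
qed

text \<open>An infinite type contains carriers of every finite size.\<close>

lemma ex_isomorphic_on_infinite_type:
  assumes "Y \<in> young_diagrams"
  shows "\<exists>A \<in> (finite_regular_L_algebras :: ('a::infinite set \<times> ('a \<Rightarrow> 'a \<Rightarrow> 'a)) set).
    L_isomorphic (Y, cone_op) A"
proof -
  have "finite Y" using assms by (simp add: young_diagrams_def)
  moreover obtain B :: "'a set" where "finite B" "card B = card Y"
    using infinite_arbitrarily_large[OF infinite_UNIV] by blast
  ultimately obtain f where "bij_betw f Y B" using finite_same_card_bij by metis
  then have "inj_on f Y" by (simp add: bij_betw_def)
  from fin_reg_transport[OF fin_reg_young_diagram[OF assms] this] show ?thesis
    using fin_reg_L_algebra_iff by blast
qed

text \<open>Well-definedness: conjugate diagrams are isomorphic, so the image of a conjugacy class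
  is one isomorphism class, that of any algebra representing \<open>Y\<close>.\<close>

lemma induced_class_eq:
  assumes Y: "Y \<in> young_diagrams" and A: "A \<in> finite_regular_L_algebras"
    and iso: "L_isomorphic (Y, cone_op) A"
  shows "induced_class (conj_rel `` {Y}) = L_iso_rel `` {A}"
proof -
  have closed: "\<forall>x\<in>fst (Y, cone_op). \<forall>y\<in>fst (Y, cone_op). snd (Y, cone_op) x y \<in> fst (Y, cone_op)"
    using cone_op_closed[OF Y] by simp
  have "(\<exists>Z\<in>conj_rel `` {Y}. L_isomorphic (Z, cone_op) B) \<longleftrightarrow> L_isomorphic A B" for B
  proof
    assume "\<exists>Z\<in>conj_rel `` {Y}. L_isomorphic (Z, cone_op) B"
    then obtain Z where Z: "(Y, Z) \<in> conj_rel" "L_isomorphic (Z, cone_op) B" by blast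
    then have "Z \<in> young_diagrams" by (simp add: conj_rel_def)
    then have YZ: "L_isomorphic (Y, cone_op) (Z, cone_op)"
      using Z(1) conj_rel_iff_isomorphic[OF Y] by blast
    show "L_isomorphic A B"
      by (rule L_isomorphic_trans[OF L_isomorphic_sym[OF iso closed] L_isomorphic_trans[OF YZ Z(2)]])
  next
    assume "L_isomorphic A B"
    then have "L_isomorphic (Y, cone_op) B" by (rule L_isomorphic_trans[OF iso])
    moreover have "(Y, Y) \<in> conj_rel" using conj_rel_iff_isomorphic[OF Y Y] L_isomorphic_refl by blast
    ultimately show "\<exists>Z\<in>conj_rel `` {Y}. L_isomorphic (Z, cone_op) B" by blast
  qed
  then show ?thesis using A by (auto simp: induced_class_def L_iso_rel_def)
qed

lemma bij_betw_induced_class: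
  "bij_betw (induced_class :: (nat \<Rightarrow> int) set set \<Rightarrow>
      ('a::infinite set \<times> ('a \<Rightarrow> 'a \<Rightarrow> 'a)) set)
    (young_diagrams // conj_rel) (finite_regular_L_algebras // L_iso_rel)"
  (is "bij_betw ?F _ _")
proof (rule bij_betw_imageI)
  show "inj_on ?F (young_diagrams // conj_rel)"
  proof (rule inj_onI)
    fix C D assume "C \<in> young_diagrams // conj_rel" "D \<in> young_diagrams // conj_rel"
      and eq: "?F C = ?F D"
    then obtain Y Z where Y: "Y \<in> young_diagrams" "C = conj_rel `` {Y}"
      and Z: "Z \<in> young_diagrams" "D = conj_rel `` {Z}" by (auto elim!: quotientE)
    obtain A :: "'a set \<times> ('a \<Rightarrow> 'a \<Rightarrow> 'a)"
      where A: "A \<in> finite_regular_L_algebras" "L_isomorphic (Y, cone_op) A"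
      using ex_isomorphic_on_infinite_type[OF Y(1)] by blast
    obtain B :: "'a set \<times> ('a \<Rightarrow> 'a \<Rightarrow> 'a)"
      where B: "B \<in> finite_regular_L_algebras" "L_isomorphic (Z, cone_op) B"
      using ex_isomorphic_on_infinite_type[OF Z(1)] by blast
    \<comment> \<open>Equal images mean that the representatives \<open>A\<close> and
      \<open>B\<close> are isomorphic, which links \<open>Y\<close> to \<open>Z\<close> through
      them.\<close>
    have "L_iso_rel `` {A} = L_iso_rel `` {B}"
      using eq induced_class_eq[OF Y(1) A] induced_class_eq[OF Z(1) B] Y Z by simp
    then have AB: "L_isomorphic A B"
      using eq_equiv_class[OF _ equiv_L_iso_rel B(1)] by (simp add: L_iso_rel_def)
    have BZ: "L_isomorphic B (Z, cone_op)"
      using L_isomorphic_sym[OF B(2)] cone_op_closed[OF Z(1)] by simp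
    have "L_isomorphic (Y, cone_op) (Z, cone_op)"
      by (rule L_isomorphic_trans[OF A(2) L_isomorphic_trans[OF AB BZ]])
    then have "(Y, Z) \<in> conj_rel" using conj_rel_iff_isomorphic Y(1) Z(1) by blast
    then show "C = D" using equiv_class_eq[OF equiv_conj_rel] Y Z by blast
  qed
  show "?F ` (young_diagrams // conj_rel) = finite_regular_L_algebras // L_iso_rel"
  proof (intro equalityI subsetI)
    fix K assume "K \<in> ?F ` (young_diagrams // conj_rel)"
    then obtain Y where Y: "Y \<in> young_diagrams" "K = ?F (conj_rel `` {Y})"
      by (auto elim!: quotientE)
    obtain A :: "'a set \<times> ('a \<Rightarrow> 'a \<Rightarrow> 'a)"
      where A: "A \<in> finite_regular_L_algebras" "L_isomorphic (Y, cone_op) A"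
      using ex_isomorphic_on_infinite_type[OF Y(1)] by blast
    show "K \<in> finite_regular_L_algebras // L_iso_rel"
      using induced_class_eq[OF Y(1) A] Y(2) A(1) by (auto intro: quotientI)
  next
    fix K :: "('a set \<times> ('a \<Rightarrow> 'a \<Rightarrow> 'a)) set"
    assume "K \<in> finite_regular_L_algebras // L_iso_rel"
    then obtain A where A: "A \<in> finite_regular_L_algebras" "K = L_iso_rel `` {A}"
      by (auto elim!: quotientE)
    then obtain Y where Y: "Y \<in> young_diagrams" "L_isomorphic (Y, cone_op) A"
      using ex_young_diagram by blast
    then have "K = ?F (conj_rel `` {Y})" using induced_class_eq[OF Y(1) A(1) Y(2)] A(2) by simp
    then show "K \<in> ?F ` (young_diagrams // conj_rel)" using Y(1) by (blast intro: quotientI)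
  qed
qed

text \<open>The last conjunct ranges over algebras on an arbitrary type \<open>'b\<close>, possibly
  finite, whereas the bijection concerns carriers in an infinite type.\<close>

theorem theorem5p9:
  shows "(\<forall>Y\<in>young_diagrams. (Y, cone_op) \<in> finite_regular_L_algebras) \<and>
    bij_betw (induced_class :: (nat \<Rightarrow> int) set set \<Rightarrow>
                ('a::infinite set \<times> ('a \<Rightarrow> 'a \<Rightarrow> 'a)) set)
      (young_diagrams // conj_rel) (finite_regular_L_algebras // L_iso_rel) \<and>
    (\<forall>A\<in>(finite_regular_L_algebras :: ('b set \<times> ('b \<Rightarrow> 'b \<Rightarrow> 'b)) set).
       \<exists>Y\<in>young_diagrams. L_isomorphic (Y, cone_op) A)"
  using fin_reg_young_diagram fin_reg_L_algebra_iff bij_betw_induced_class ex_young_diagram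
  by blast

end
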